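(* Let $w\ge 1$ be an integer and let $\mathcal T_w$ be the set of configurations $x\in\{0,1\}^{\mathbb Z}$ with $\operatorname{supp}(x)\subseteq[-w,w]$ and $x_0=1$. For $x\in\mathcal T_w$ let $$H_1(x)=\max\{h\ge 0: F^t(x)_0=1\text{ for all }0\le t\le h\}.$$ Let $q$ be the least even integer greater than $w$. Then $$\max_{x\in\mathcal T_w}H_1(x)=q-1\qquad\text{and}\qquad \#\left\{x\in\mathcal T_w: H_1(x)=q-1\right\}=2^w.$$
   Context: Rule 30 is the map $F:\{0,1\}^{\mathbb Z}\to\{0,1\}^{\mathbb Z}$ given by $F(x)_i=x_{i-1}\oplus(x_i\lor x_{i+1})$, where $\oplus$ is addition modulo $2$ and $\lor$ is Boolean disjunction. $F^t$ is the $t$-fold iterate, with $F^0(x)=x$. The support is $\operatorname{supp}(x)=\{i\in\mathbb Z:x_i=1\}$. *)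

theory Defs
  imports Main
begin

text \<open>Configurations: \<open>True\<close> encodes the symbol 1 and \<open>False\<close> the symbol 0,
  so that \<open>\<noteq>\<close> on \<open>bool\<close> is addition modulo 2.\<close>

type_synonym config = "int \<Rightarrow> bool"

definition rule30 :: "config \<Rightarrow> config" where
  "rule30 x = (\<lambda>i. x (i - 1) \<noteq> (x i \<or> x (i + 1)))"

definition supp :: "config \<Rightarrow> int set" where
  "supp x = {i. x i}"

definition T :: "nat \<Rightarrow> config set" where
  "T w = {x. supp x \<subseteq> {- int w..int w} \<and> x 0}"

definition one_heights :: "config \<Rightarrow> nat set" where
  "one_heights x = {h. \<forall>t\<le>h. (rule30 ^^ t) x 0}"

text \<open>\<open>Max\<close> is meaningful only on finite nonempty sets; \<open>one_heights x\<close> contains 0 when \<open>x 0\<close>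
  holds, but its finiteness has to be established separately.\<close>

definition H1 :: "config \<Rightarrow> nat" where
  "H1 x = Max (one_heights x)"

end

theory Submission
  imports Defs
begin

text \<open>
  Rule 30 is left-permutive: \<open>x (i - 1)\<close> can be recovered from \<open>rule30 x i\<close>, \<open>x i\<close> and
  \<open>x (i + 1)\<close>. Prescribing the time column at the origin therefore prescribes the cells to its
  left once the right half is known. For the constant column 1 the right half turns out to be
  irrelevant, since a cell holding 1 already decides the disjunction: the column at \<open>-1\<close> must be
  constantly 0, the column at \<open>-2\<close> constantly 1, and so on, each for one time step fewer than the
  column on its right. So the origin holds 1 during the times \<open>0, \<dots>, h\<close> if and only if the
  initial cells \<open>0, -1, \<dots>, -h\<close> read \<open>1, 0, 1, 0, \<dots>\<close> (\<open>mem_one_heights_iff_alternating\<close>).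

  A configuration supported on \<open>[-w, w]\<close> breaks this pattern at the latest at \<open>-q\<close>, the first even
  position beyond the support, so no height reaches \<open>q\<close>. The pattern up to \<open>-(q - 1)\<close> is compatible
  with the support condition, because the positions between \<open>w\<close> and \<open>q\<close> are odd. It fixes the cells
  in \<open>[-w, 0]\<close> and leaves the \<open>w\<close> cells in \<open>[1, w]\<close> free, whence the count \<open>2 ^ w\<close>.
\<close>

text \<open>
  Two adjacent cells of an alternating pattern always contain a 1, so the disjunction in the rule
  is 1, and the new value is the negation of the left neighbour. At the origin the cell itself
  holds 1, which is why the unknown cell at position 1 does not matter.
\<close>

lemma rule30_alternating_step:
  assumes "\<forall>i\<le>j. x (- int i) = even i"
  shows "rule30 x (- int j) = even j \<longleftrightarrow> x (- int (Suc j)) = even (Suc j)"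
proof -
  have "x (- int j) \<or> x (- int j + 1)"
  proof (cases j)
    case 0
    then show ?thesis using assms by auto
  next
    case (Suc i)
    have "- int j + 1 = - int i"
      using Suc by simp
    moreover have "x (- int i) = even i" "x (- int j) = even j"
      by (rule assms[rule_format], simp add: Suc, rule assms[rule_format], simp)
    ultimately show ?thesis using Suc by simp
  qed
  then have "rule30 x (- int j) = (\<not> x (- int j - 1))"
    by (auto simp: rule30_def)
  moreover have "- int j - 1 = - int (Suc j)"
    by simp
  ultimately show ?thesis
    by (metis even_Suc)
qed

text \<open>
  The pattern shrinks by exactly one cell per time step. Read from right to left this is the
  left-permutive reconstruction of the initial cells, one further cell at a time.
\<close>

lemma alternating_Suc_iff:
  "(\<forall>j\<le>Suc h. x (- int j) = even j) \<longleftrightarrow> x 0 \<and> (\<forall>j\<le>h. rule30 x (- int j) = even j)"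
proof (induction h)
  case 0
  show ?case
    using rule30_alternating_step[of 0 x] by (auto simp: le_Suc_eq)
next
  case (Suc h)
  show ?case
    using Suc.IH rule30_alternating_step[of "Suc h" x] by (auto simp: le_Suc_eq)
qed

lemma mem_one_heights_Suc_iff:
  "Suc h \<in> one_heights x \<longleftrightarrow> x 0 \<and> h \<in> one_heights (rule30 x)"
proof -
  have "(\<forall>t\<le>Suc h. (rule30 ^^ t) x 0) \<longleftrightarrow> x 0 \<and> (\<forall>t\<le>h. (rule30 ^^ Suc t) x 0)"
    by (metis Suc_le_mono funpow_0 le0 not0_implies_Suc)
  then show ?thesis
    by (simp add: one_heights_def funpow_Suc_right del: funpow.simps)
qed

lemma mem_one_heights_iff_alternating:
  "h \<in> one_heights x \<longleftrightarrow> (\<forall>j\<le>h. x (- int j) = even j)"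
proof (induction h arbitrary: x)
  case 0
  show ?case by (simp add: one_heights_def)
next
  case (Suc h)
  show ?case
    by (simp only: mem_one_heights_Suc_iff alternating_Suc_iff Suc.IH)
qed

text \<open>
  Among the configurations supported on \<open>[-w, w]\<close>, the alternating ones correspond to the subsets
  of \<open>[1, w]\<close>, namely the positive part of the support. The hypothesis on \<open>h\<close> says that the pattern
  asks for no 1 outside the support window.
\<close>

lemma card_alternating:
  assumes "w \<le> h" and odd_outside: "\<And>j. w < j \<Longrightarrow> j \<le> h \<Longrightarrow> odd j"
  shows "card {x \<in> T w. \<forall>j\<le>h. x (- int j) = even j} = 2 ^ w"
proof -
  let ?A = "{x \<in> T w. \<forall>j\<le>h. x (- int j) = even j}"
  let ?f = "\<lambda>S i. i \<in> S \<or> (- int w \<le> i \<and> i \<le> 0 \<and> even i)"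
  let ?g = "\<lambda>x. {i \<in> {1..int w}. x i}"
  have "bij_betw ?f (Pow {1..int w}) ?A"
  proof (rule bij_betw_byWitness[where f' = ?g])
    show "\<forall>S\<in>Pow {1..int w}. ?g (?f S) = S"
      by auto
    show "\<forall>x\<in>?A. ?f (?g x) = x"
    proof (intro ballI ext)
      fix x i
      assume x: "x \<in> ?A"
      have window: "x i \<Longrightarrow> - int w \<le> i \<and> i \<le> int w"
        using x by (auto simp: T_def supp_def)
      show "?f (?g x) i = x i"
      proof (cases "i \<le> 0 \<and> - int w \<le> i")
        case True
        then obtain j where j: "i = - int j"
          by (metis nonpos_int_cases)
        then have "x i = even i"
          using x True \<open>w \<le> h\<close> by auto
        then show ?thesis using True by auto
      next
        case False
        then show ?thesis using window by auto
      qed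
    qed
    show "?f ` Pow {1..int w} \<subseteq> ?A"
    proof (intro image_subsetI CollectI conjI allI impI)
      fix S
      assume S: "S \<in> Pow {1..int w}"
      then show "?f S \<in> T w"
        by (auto simp: T_def supp_def)
      fix j
      assume "j \<le> h"
      moreover have "- int j \<notin> S"
        using S by auto
      ultimately show "?f S (- int j) = even j"
        using odd_outside[of j] by (cases "j \<le> w") auto
    qed
    show "?g ` ?A \<subseteq> Pow {1..int w}"
      by auto
  qed
  then have "card (Pow {1..int w}) = card ?A"
    by (rule bij_betw_same_card)
  then show ?thesis
    by (simp only: card_Pow finite_atLeastAtMost_int card_atLeastAtMost_int) simp
qed

theorem theorem7:
  fixes w q :: nat
  assumes "w \<ge> 1"
    and "q = (LEAST n. even n \<and> n > w)"
  shows "(\<forall>x\<in>T w. finite (one_heights x))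
    \<and> Max (H1 ` T w) = q - 1
    \<and> card {x \<in> T w. H1 x = q - 1} = 2 ^ w"
proof -
  have "even (2 * w + 2) \<and> w < 2 * w + 2"
    by simp
  then have q: "even q \<and> w < q"
    unfolding assms(2) by (rule LeastI)
  then have "w \<le> q - 1"
    by linarith
  have odd_below_q: "odd j" if "w < j" "j \<le> q - 1" for j
  proof
    assume "even j"
    then have "q \<le> j"
      unfolding assms(2) using that by (intro Least_le) simp
    then show False using that q by linarith
  qed
  have heights: "one_heights x \<subseteq> {..q - 1}" if "x \<in> T w" for x
  proof
    fix h
    assume "h \<in> one_heights x"
    moreover have "\<not> x (- int q)"
      using that q by (auto simp: T_def supp_def)
    ultimately have "\<not> q \<le> h"
      using q by (auto simp: mem_one_heights_iff_alternating)
    then show "h \<in> {..q - 1}" by simp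
  qed
  have fin: "finite (one_heights x)" if "x \<in> T w" for x
    using heights[OF that] by (rule finite_subset) simp
  have H1_mem: "H1 x \<in> one_heights x" if "x \<in> T w" for x
  proof -
    have "0 \<in> one_heights x"
      using that by (simp add: one_heights_def T_def)
    then show ?thesis
      unfolding H1_def using fin[OF that] by (intro Max_in) auto
  qed
  have H1_le: "H1 x \<le> q - 1" if "x \<in> T w" for x
    using H1_mem[OF that] heights[OF that] by auto
  have "H1 x = q - 1 \<longleftrightarrow> q - 1 \<in> one_heights x" if "x \<in> T w" for x
    using H1_mem[OF that] H1_le[OF that] Max_ge[OF fin[OF that]]
    by (metis H1_def le_antisym)
  then have "{x \<in> T w. H1 x = q - 1}
      = {x \<in> T w. \<forall>j\<le>q - 1. x (- int j) = even j}"
    by (auto simp: mem_one_heights_iff_alternating)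
  then have card: "card {x \<in> T w. H1 x = q - 1} = 2 ^ w"
    using card_alternating[OF \<open>w \<le> q - 1\<close> odd_below_q] by (simp only:)
  \<comment> \<open>The count is positive, so the bound \<open>q - 1\<close> is attained.\<close>
  then obtain x where "x \<in> T w" "H1 x = q - 1"
    by (metis (mono_tags, lifting) card.empty empty_Collect_eq power_not_zero zero_neq_numeral)
  then have "q - 1 \<in> H1 ` T w"
    by (metis imageI)
  moreover have bounded: "H1 ` T w \<subseteq> {..q - 1}"
    using H1_le by blast
  moreover have "finite (H1 ` T w)"
    using bounded by (rule finite_subset) simp
  ultimately have "Max (H1 ` T w) = q - 1"
    by (intro Max_eqI) auto
  with fin card show ?thesis by blast
qed

end
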